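(* For every integer $k\ge 0$, the Ward-Lah numbers $W(n,k)$ satisfy the following identity of formal power series in $x$: $$\sum_{n=k}^{\infty}W(n-k,k)\,\frac{x^n}{n!}=\frac{1}{k!}\left(\frac{x^{2k}}{(1-x)^k}\right).$$
   Context: Partition transformation: for integers $n,k\ge 0$ and a sequence $a_1,a_2,\dots$, $$P_n^k(a_1,a_2,\dots)=\sum_{q}(-1)^{q_0}\prod_{j=0}^{\ell(q)-1}\binom{q_j}{q_{j+1}}a_{j+1}^{q_j},$$ where the sum is over integer partitions $q=(q_0\ge q_1\ge\dots)$ of $n=q_0+q_1+\cdots$ with $q_0=k$; $\ell(q)$ is the length of $q$ (number of positive parts), so $q_{\ell(q)-1}>0$ and $q_{\ell(q)}=0$. Falling factorial: $x^{\underline{n}}=\prod_{i=0}^{n-1}(x-i)$. Ward-Lah numbers: for integers $n\ge k\ge 0$, $W(n,k)=(-1)^k (n+k)^{\underline{n}}\,P_n^k(1,1,\dots)$ (all $a_i=1$), with $W(0,0)=1$, $W(n,0)=0$ for $n\ge 1$, $W(0,k)=0$ for $k\ge 1$, and $W(n,k)=0$ for $k>n$. *)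

theory Defs
  imports "HOL-Computational_Algebra.Formal_Power_Series"
begin

text \<open>
  An integer partition of \<open>n\<close> is an infinite weakly decreasing sequence
  \<open>q 0 \<ge> q 1 \<ge> \<dots>\<close> of naturals with finitely many nonzero terms and sum \<open>n\<close>; so
  \<open>q j = 0\<close> for all \<open>j\<close> from the length of \<open>q\<close> on.
\<close>

definition support :: "(nat \<Rightarrow> nat) \<Rightarrow> nat set" where
  "support q = {j. q j > 0}"

definition is_partition :: "nat \<Rightarrow> (nat \<Rightarrow> nat) \<Rightarrow> bool" where
  "is_partition n q \<longleftrightarrow> antimono q \<and> finite (support q) \<and> (\<Sum>j\<in>support q. q j) = n"

definition partition_length :: "(nat \<Rightarrow> nat) \<Rightarrow> nat" where
  "partition_length q = card (support q)"

text \<open>The sequence is indexed from \<open>1\<close>: the value \<open>a 0\<close> is never used.\<close>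

definition partition_transform :: "nat \<Rightarrow> nat \<Rightarrow> (nat \<Rightarrow> 'a) \<Rightarrow> 'a::comm_ring_1" where
  "partition_transform n k a =
     (\<Sum>q | is_partition n q \<and> q 0 = k.
        (- 1) ^ q 0 *
        (\<Prod>j<partition_length q. of_nat (q j choose q (j + 1)) * a (j + 1) ^ q j))"

definition falling_factorial :: "'a::comm_ring_1 \<Rightarrow> nat \<Rightarrow> 'a" where
  "falling_factorial x n = (\<Prod>i<n. x - of_nat i)"

definition ward_lah :: "nat \<Rightarrow> nat \<Rightarrow> int" where
  "ward_lah n k =
     (if k \<le> n
      then (- 1) ^ k * falling_factorial (int (n + k)) n * partition_transform n k (\<lambda>_. 1)
      else 0)"

text \<open>The index set of the sum in \<open>partition_transform\<close> is finite, so that sum is a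
  genuine one.\<close>

lemma partition_eq_0:
  assumes "is_partition n q" "j \<ge> n"
  shows "q j = 0"
proof (rule ccontr)
  assume "q j \<noteq> 0"
  have anti: "antimono q" and fin: "finite (support q)" and sum: "(\<Sum>i\<in>support q. q i) = n"
    using assms(1) by (auto simp: is_partition_def)
  have pos: "q i \<ge> 1" if "i \<le> j" for i
    using antimonoD[OF anti that] \<open>q j \<noteq> 0\<close> by linarith
  then have sub: "{..j} \<subseteq> support q"
    by (force simp: support_def)
  have "Suc j = (\<Sum>i\<le>j. 1)" by simp
  also have "\<dots> \<le> (\<Sum>i\<le>j. q i)"
    by (rule sum_mono) (use pos in auto)
  also have "\<dots> \<le> (\<Sum>i\<in>support q. q i)"
    by (rule sum_mono2[OF fin sub]) auto
  finally show False using sum assms(2) by simp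
qed

lemma partition_le:
  assumes "is_partition n q"
  shows "q j \<le> n"
proof (cases "j \<in> support q")
  case True
  with assms show ?thesis
    using member_le_sum[of j "support q" q] by (auto simp: is_partition_def)
qed (simp add: support_def)

lemma finite_partitions: "finite {q. is_partition n q}"
proof (rule finite_subset)
  show "finite {q :: nat \<Rightarrow> nat. \<forall>j. (j \<in> {..<n} \<longrightarrow> q j \<in> {..n}) \<and> (j \<notin> {..<n} \<longrightarrow> q j = 0)}"
    by (rule finite_set_of_finite_funs) auto
  show "{q. is_partition n q} \<subseteq>
        {q. \<forall>j. (j \<in> {..<n} \<longrightarrow> q j \<in> {..n}) \<and> (j \<notin> {..<n} \<longrightarrow> q j = 0)}"
    using partition_eq_0 partition_le by auto
qed

text \<open>The boundary values of the Ward-Lah numbers follow from the definition.\<close>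

lemma ward_lah_0_0: "ward_lah 0 0 = 1"
proof -
  have "{q. is_partition 0 q \<and> q 0 = 0} = {\<lambda>_. 0}"
    using partition_eq_0 by (auto simp: is_partition_def support_def monotone_def)
  then show ?thesis
    by (simp add: ward_lah_def falling_factorial_def partition_transform_def
        partition_length_def support_def)
qed

lemma ward_lah_n_0:
  assumes "n \<ge> 1"
  shows "ward_lah n 0 = 0"
proof -
  have "False" if q: "is_partition n q" "q 0 = 0" for q
  proof -
    have "q j = 0" for j
      using antimonoD[of q 0 j] q by (simp add: is_partition_def)
    then show False using q assms by (simp add: is_partition_def support_def)
  qed
  then have "{q. is_partition n q \<and> q 0 = 0} = {}" by blast
  then show ?thesis
    unfolding ward_lah_def partition_transform_def by (simp only: sum.empty mult_zero_right if_cancel)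
qed

lemma ward_lah_eq_0: "n < k \<Longrightarrow> ward_lah n k = 0"
  by (simp add: ward_lah_def)

end

theory Submission
  imports Defs
begin

text \<open>
  Removing the largest part of a partition gives a recurrence for the partition transform in
  which the first part \<open>k\<close> is fixed and the second part runs over \<open>j \<le> k\<close>. For \<open>a = 1\<close> it says that the
  generating functions \<open>F k = (\<Sum>n. (-1)^k * P n k * x^n)\<close> satisfy \<open>F k = x^k * (\<Sum>j\<le>k. (k choose j) * F j)\<close>
  for \<open>k > 0\<close>. Since \<open>1 + x / (1 - x) = 1 / (1 - x)\<close>, the powers of \<open>x / (1 - x)\<close> satisfy the same
  recurrence by the binomial theorem. The factor \<open>(n + k)! / k!\<close> of the Ward-Lah number
  cancels the factorial of the exponential generating function.
\<close>

text \<open>\<open>case_nat k r\<close> prepends the part \<open>k\<close> to \<open>r\<close>, the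
  inverse of deleting the largest part. The next lemmas record its effect on support, monotonicity,
  sum and length.\<close>

lemma support_case_nat:
  assumes "k > 0"
  shows "support (case_nat k r) = insert 0 (Suc ` support r)"
proof (rule set_eqI)
  show "j \<in> support (case_nat k r) \<longleftrightarrow> j \<in> insert 0 (Suc ` support r)" for j
    using assms by (cases j) (auto simp: support_def)
qed

lemma antimono_case_nat:
  "antimono (case_nat k r) \<longleftrightarrow> r 0 \<le> (k :: nat) \<and> antimono r"
  unfolding decseq_Suc_iff by (auto split: nat.splits)

lemma is_partition_case_nat:
  assumes "k > 0"
  shows "is_partition n (case_nat k r) \<longleftrightarrow> k \<le> n \<and> r 0 \<le> k \<and> is_partition (n - k) r"
proof -
  have "(\<Sum>j\<in>support (case_nat k r). case_nat k r j) = k + (\<Sum>j\<in>support r. r j)"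
    if "finite (support r)"
    using that by (simp add: support_case_nat[OF assms] sum.reindex)
  moreover have "finite (support (case_nat k r)) \<longleftrightarrow> finite (support r)"
    by (simp add: support_case_nat[OF assms] finite_image_iff)
  ultimately show ?thesis
    unfolding is_partition_def antimono_case_nat by auto
qed

lemma partition_length_case_nat:
  assumes "k > 0" "is_partition n r"
  shows "partition_length (case_nat k r) = Suc (partition_length r)"
  using assms by (simp add: partition_length_def support_case_nat is_partition_def card_image)

lemma partition_transform_0_right: "partition_transform n 0 a = (if n = 0 then 1 else 0)"
proof -
  have zero: "q = (\<lambda>_. 0)" if "is_partition n q" "q 0 = 0" for q
    using antimonoD[of q 0] that by (force simp: is_partition_def)
  have "is_partition n (\<lambda>_. 0) \<longleftrightarrow> n = 0"
    by (auto simp: is_partition_def support_def monotone_def)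
  with zero have "{q. is_partition n q \<and> q 0 = 0} = (if n = 0 then {\<lambda>_. 0} else {})"
    by (auto split: if_splits)
  then show ?thesis
    by (simp add: partition_transform_def partition_length_def support_def)
qed

lemma partition_transform_eq_0: "n < k \<Longrightarrow> partition_transform n k a = 0"
proof -
  assume "n < k"
  then have "{q. is_partition n q \<and> q 0 = k} = {}"
    using partition_le[of n _ 0] by fastforce
  then show ?thesis
    unfolding partition_transform_def by (simp only: sum.empty)
qed

text \<open>The factor of index 0 in the product is \<open>(k choose r 0) * a 1 ^ k\<close>. The
  other factors form the product for the remainder \<open>r\<close> with the sequence shifted to
  \<open>a \<circ> Suc\<close>. The factor \<open>(- 1) ^ j\<close> cancels the sign inside
  \<open>partition_transform (n - k) j\<close>.\<close>

lemma partition_transform_rec: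
  assumes "0 < k" "k \<le> n"
  shows "partition_transform n k a =
    (- a 1) ^ k *
      (\<Sum>j\<le>k. (- 1) ^ j * of_nat (k choose j) * partition_transform (n - k) j (a \<circ> Suc))"
proof -
  \<comment> \<open>The summand without its sign: the sign depends only on \<open>q 0\<close>, so it
    is constant over each sum.\<close>
  define weight :: "(nat \<Rightarrow> 'a) \<Rightarrow> (nat \<Rightarrow> nat) \<Rightarrow> 'a" where
    "weight = (\<lambda>a q. \<Prod>j<partition_length q. of_nat (q j choose q (j + 1)) * a (j + 1) ^ q j)"
  have transform: "partition_transform m j b =
      (- 1) ^ j * (\<Sum>q | is_partition m q \<and> q 0 = j. weight b q)" for m j b
    by (simp add: partition_transform_def weight_def sum_distrib_left)
  have bij: "bij_betw (case_nat k) {r. is_partition (n - k) r \<and> r 0 \<le> k} {q. is_partition n q \<and> q 0 = k}"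
  proof (rule bij_betw_byWitness[where f' = "\<lambda>q. q \<circ> Suc"])
    have "case_nat k (q \<circ> Suc) = q" if "q 0 = k" for q
      using that by (auto split: nat.splits)
    then show "\<forall>q\<in>{q. is_partition n q \<and> q 0 = k}. case_nat k (q \<circ> Suc) = q"
      and "(\<lambda>q. q \<circ> Suc) ` {q. is_partition n q \<and> q 0 = k} \<subseteq> {r. is_partition (n - k) r \<and> r 0 \<le> k}"
      using is_partition_case_nat[OF assms(1), of n "q \<circ> Suc" for q] by fastforce+
  qed (use assms is_partition_case_nat in auto)
  have weight: "weight a (case_nat k r) = a 1 ^ k * (of_nat (k choose r 0) * weight (a \<circ> Suc) r)"
    if "is_partition (n - k) r" for r
    unfolding weight_def partition_length_case_nat[OF assms(1) that]
    by (subst prod.lessThan_Suc_shift) (simp add: mult_ac)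
  have "(\<Sum>q | is_partition n q \<and> q 0 = k. weight a q) =
      a 1 ^ k * (\<Sum>r | is_partition (n - k) r \<and> r 0 \<le> k. of_nat (k choose r 0) * weight (a \<circ> Suc) r)"
    unfolding sum.reindex_bij_betw[OF bij, symmetric] sum_distrib_left
    by (rule sum.cong) (use weight in auto)
  \<comment> \<open>Group the remainders by their largest part \<open>r 0\<close>, the second part
    of the original partition.\<close>
  also have "(\<Sum>r | is_partition (n - k) r \<and> r 0 \<le> k. of_nat (k choose r 0) * weight (a \<circ> Suc) r) =
      (\<Sum>j\<le>k. \<Sum>r | r \<in> {r. is_partition (n - k) r \<and> r 0 \<le> k} \<and> r 0 = j.
        of_nat (k choose r 0) * weight (a \<circ> Suc) r)"
    by (rule sum.group[symmetric]) (auto intro: finite_subset[OF _ finite_partitions])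
  also have "\<dots> = (\<Sum>j\<le>k. of_nat (k choose j) *
      (\<Sum>r | is_partition (n - k) r \<and> r 0 = j. weight (a \<circ> Suc) r))"
    unfolding sum_distrib_left by (intro sum.cong) auto
  also have "\<dots> = (\<Sum>j\<le>k. (- 1) ^ j * of_nat (k choose j) * partition_transform (n - k) j (a \<circ> Suc))"
    by (intro sum.cong) (auto simp: transform mult_ac)
  finally show ?thesis
    by (simp add: transform power_minus[of "a (Suc 0)"] mult_ac)
qed

text \<open>Constant sequences are fixed by the shift \<open>a \<circ> Suc\<close>, so the
  recurrence closes on itself. Strong induction on \<open>n\<close> is needed because removing the
  part \<open>k\<close> lowers \<open>n\<close> by \<open>k\<close>; all \<open>k\<close> are
  treated at once.\<close>

lemma of_int_partition_transform_1:
  "of_int (partition_transform n k (\<lambda>_. 1)) =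
    (- 1) ^ k * fps_nth ((fps_X * inverse (1 - fps_X) :: 'a::field_char_0 fps) ^ k) n"
proof (induction n arbitrary: k rule: less_induct)
  case (less n)
  define G where "G = (fps_X * inverse (1 - fps_X) :: 'a fps)"
  have G_eq: "G = fps_X * (1 + G)"
  proof -
    have "(1 - fps_X) * inverse (1 - fps_X :: 'a fps) = 1"
      by (simp add: inverse_mult_eq_1')
    then have "inverse (1 - fps_X) = 1 + G"
      by (simp add: G_def algebra_simps)
    then show ?thesis
      by (simp add: G_def)
  qed
  have G_power: "G ^ k = fps_X ^ k * (\<Sum>j\<le>k. of_nat (k choose j) * G ^ j)"
    by (subst G_eq) (simp add: power_mult_distrib binomial_ring add.commute[of 1])
  consider "k = 0" | "n < k" | "0 < k" "k \<le> n" by linarith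
  then show ?case
  proof cases
    case 1
    then show ?thesis by (simp add: partition_transform_0_right)
  next
    case 2
    \<comment> \<open>The factor \<open>fps_X ^ k\<close> of \<open>G ^ k\<close> makes the
      coefficients below \<open>k\<close> vanish.\<close>
    then show ?thesis
      using G_power by (simp add: partition_transform_eq_0 fps_X_power_mult_nth flip: G_def)
  next
    case 3
    have IH: "of_int (partition_transform (n - k) j (\<lambda>_. 1)) = (- 1) ^ j * fps_nth (G ^ j) (n - k)" for j
      using less.IH[of "n - k" j] 3 by (simp add: G_def)
    have "of_int (partition_transform n k (\<lambda>_. 1)) =
        (- 1) ^ k * (\<Sum>j\<le>k. of_nat (k choose j) * fps_nth (G ^ j) (n - k))"
      by (simp add: partition_transform_rec[OF 3] o_def IH mult_ac)
    also have "(\<Sum>j\<le>k. of_nat (k choose j) * fps_nth (G ^ j) (n - k)) = fps_nth (G ^ k) n"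
      using 3 by (subst G_power)
        (simp add: fps_X_power_mult_nth fps_sum_nth flip: fps_of_nat)
    finally show ?thesis by (simp add: G_def)
  qed
qed

text \<open>Passing from \<open>n\<close> to \<open>Suc n\<close> adds a new leading factor; the
  remaining factors are those of the falling factorial of \<open>n + k\<close>.\<close>

lemma falling_factorial_of_nat:
  "falling_factorial (of_nat (n + k)) n * fact k = (fact (n + k) :: 'a::{comm_ring_1,semiring_char_0})"
proof (induction n)
  case (Suc n)
  have "falling_factorial (of_nat (Suc n + k)) (Suc n) =
      of_nat (Suc n + k) * (falling_factorial (of_nat (n + k)) n :: 'a)"
    unfolding falling_factorial_def
    by (subst prod.lessThan_Suc_shift) (simp add: algebra_simps)
  then show ?case
    using Suc.IH by (simp add: mult.assoc)
qed (simp add: falling_factorial_def)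

theorem theorem2p11:
  fixes k :: nat
  shows "Abs_fps (\<lambda>n. if n \<ge> k then of_int (ward_lah (n - k) k) / fact n else 0) =
         fps_const (1 / fact k) *
           ((fps_X :: 'a::field_char_0 fps) ^ (2 * k) / (1 - fps_X) ^ k)"
proof (rule fps_ext)
  fix n
  define G where "G = (fps_X * inverse (1 - fps_X) :: 'a fps)"
  \<comment> \<open>For \<open>m < k\<close> the transform vanishes, which agrees with the default 0
    of \<open>ward_lah\<close>. Otherwise the two signs \<open>(- 1) ^ k\<close> cancel.\<close>
  have ward_lah: "of_int (ward_lah m k) * fact k = fact (m + k) * fps_nth (G ^ k) m" for m
  proof -
    have "of_int (ward_lah m k) * fact k =
        (of_int ((- 1) ^ k * (falling_factorial (int (m + k)) m * fact k) *
          partition_transform m k (\<lambda>_. 1)) :: 'a)"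
      by (simp add: ward_lah_def partition_transform_eq_0)
    also have "\<dots> = fact (m + k) * fps_nth (G ^ k) m"
      unfolding falling_factorial_of_nat
      by (simp add: of_int_partition_transform_1 G_def mult_ac)
    finally show ?thesis .
  qed
  \<comment> \<open>Half of the exponent \<open>2 * k\<close> belongs to \<open>G ^ k\<close>; the
    other half shifts the coefficient index from \<open>n - k\<close> to \<open>n\<close>.\<close>
  have "(fps_X :: 'a fps) ^ (2 * k) / (1 - fps_X) ^ k = fps_X ^ k * G ^ k"
    by (simp add: G_def fps_divide_unit fps_nth_power_0 fps_inverse_power power_mult_distrib
        mult_2 power_add mult.assoc)
  then show "fps_nth (Abs_fps (\<lambda>n. if n \<ge> k then of_int (ward_lah (n - k) k) / fact n else 0)) n =
      fps_nth (fps_const (1 / fact k) * ((fps_X :: 'a fps) ^ (2 * k) / (1 - fps_X) ^ k)) n"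
    using ward_lah[of "n - k"] by (auto simp: fps_X_power_mult_nth field_simps)
qed

end
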